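(* Let $(X,d)$ be a metric space, let $\Phi:X\to\mathbb R\cup\{+\infty\}$ be a proper functional bounded from below, and let $\gamma\ge0$. Suppose that the global $\gamma$-slope $|\partial\Phi|_\gamma:X\to\mathbb R\cup\{+\infty\}$ is a strong upper gradient of $\Phi$ and that $$\{w\in X:\Phi(w)<\inf_X\Phi+2/\gamma\}\cap\mathcal M(|\partial\Phi|_\gamma)\neq\emptyset,$$ where $2/\gamma$ is interpreted as $+\infty$ if $\gamma=0$. If $T:X\to X$ is a mapping satisfying $$\Phi(v)\ge\Phi(T(v))+d(v,T(v))\quad\text{for all } v\in X,$$ then there exists $\hat u\in\mathcal M(|\partial\Phi|_\gamma)$ such that $T(\hat u)=\hat u$.
   Context: Notation: $\operatorname{dom}\Phi=\{u\in X:\Phi(u)<+\infty\}$; proper means $\operatorname{dom}\Phi\ne\emptyset$. The metric space is not assumed complete. Global $\gamma$-slope: for $u\in\operatorname{dom}\Phi$, $|\partial\Phi|_\gamma(u):=\max\left\{\sup_{v\in X\setminus\{u\}}\left(\frac{\Phi(u)-\Phi(v)}{d(u,v)}-\frac{\gamma}{2}d(u,v)\right),0\right\}$, and $|\partial\Phi|_\gamma(u):=+\infty$ for $u\notin\operatorname{dom}\Phi$. Locally absolutely continuous curve: a curve $v:(0,+\infty)\to X$ for which there is a nonnegative $m\in L^1_{\mathrm{loc}}(0,+\infty)$ with $d(v(t),v(s))\le\int_s^t m(r)\,dr$ for all $0<s\le t$. For such a curve the metric derivative $|\dot v|(t):=\lim_{h\to0}\frac{d(v(t+h),v(t))}{|h|}$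 exists for a.e. $t$ and belongs to $L^1_{\mathrm{loc}}(0,+\infty)$. Strong upper gradient of $\Phi$: a nonnegative function $g:X\to\mathbb R\cup\{+\infty\}$ such that for every locally absolutely continuous curve $v:(0,+\infty)\to X$ with values in $\operatorname{dom}\Phi$, the function $g\circ v$ is Borel measurable and $|\Phi(v(t))-\Phi(v(s))|\le\int_s^t g(v(r))\,|\dot v|(r)\,dr$ for all $0<s\le t$ (the right-hand side may be $+\infty$). Gradient flow of $\Phi$ with respect to a strong upper gradient $g$: a locally absolutely continuous curve $v:(0,+\infty)\to X$ such that (1) $v(t)\in\operatorname{dom}\Phi$ for all $t>0$; (2) $\Phi(v(t))-\Phi(v(s))\le-\frac12\int_s^t|\dot v|(r)^2\,dr-\frac12\int_s^t g(v(r))^2\,dr$ for all $s,t\in(0,+\infty)$ (integrals are oriented). $\mathcal M(g)$ is the set of all $u\in\operatorname{dom}\Phi$ for which there exists a gradient flow $v:(0,+\infty)\to X$ of $\Phi$ with respect to $g$ with $\lim_{t\to0^+}v(t)=u$ and $\lim_{t\to0^+}\Phi(v(t))=\Phi(u)$. *)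

theory Defs
  imports "HOL-Analysis.Analysis"
begin

text \<open>
  Functionals with values in $R \cup \{+\infty\}$ are modelled as \<^typ>\<open>ereal\<close>-valued functions; the
  value \<open>-\<infinity>\<close> is excluded by \<open>proper_functional\<close> below.
\<close>

definition eff_dom :: "('a \<Rightarrow> ereal) \<Rightarrow> 'a set" where
  "eff_dom \<Phi> = {u. \<Phi> u < \<infinity>}"

definition proper_functional :: "('a \<Rightarrow> ereal) \<Rightarrow> bool" where
  "proper_functional \<Phi> \<longleftrightarrow> (\<forall>u. \<Phi> u \<noteq> -\<infinity>) \<and> eff_dom \<Phi> \<noteq> {}"

definition bounded_from_below :: "('a \<Rightarrow> ereal) \<Rightarrow> bool" where
  "bounded_from_below \<Phi> \<longleftrightarrow> (\<exists>c::real. \<forall>u. ereal c \<le> \<Phi> u)"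

text \<open>
  A point \<open>v\<close> outside the domain contributes \<open>-\<infinity>\<close> to the supremum, and the supremum over the
  empty set (one-point space) is \<open>-\<infinity>\<close>; both are absorbed by the maximum with \<open>0\<close>.
\<close>

definition global_slope :: "real \<Rightarrow> ('a::metric_space \<Rightarrow> ereal) \<Rightarrow> 'a \<Rightarrow> ereal" where
  "global_slope \<gamma> \<Phi> u =
     (if u \<in> eff_dom \<Phi>
      then max (SUP v\<in>UNIV - {u}. (\<Phi> u - \<Phi> v) / ereal (dist u v) - ereal (\<gamma> / 2 * dist u v)) 0
      else \<infinity>)"

text \<open>
  Curves on $(0,+\infty)$ are total functions on \<^typ>\<open>real\<close>; none of the notions below depends on
  their values at nonpositive times.
\<close>

definition loc_abs_cont :: "(real \<Rightarrow> 'a::metric_space) \<Rightarrow> bool" where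
  "loc_abs_cont v \<longleftrightarrow>
     (\<exists>m :: real \<Rightarrow> real.
        (\<forall>r>0. 0 \<le> m r) \<and>
        (\<forall>s t. 0 < s \<and> s \<le> t \<longrightarrow>
           set_integrable lborel {s..t} m \<and> dist (v t) (v s) \<le> (LBINT r:{s..t}. m r)))"

text \<open>
  For a locally absolutely continuous curve the limit exists at almost every time; the value \<open>0\<close>
  at the exceptional times is an arbitrary choice that no integral below sees.
\<close>

definition metric_deriv :: "(real \<Rightarrow> 'a::metric_space) \<Rightarrow> real \<Rightarrow> real" where
  "metric_deriv v t =
     (if \<exists>l. ((\<lambda>h. dist (v (t + h)) (v t) / \<bar>h\<bar>) \<longlongrightarrow> l) (at 0)
      then Lim (at 0) (\<lambda>h. dist (v (t + h)) (v t) / \<bar>h\<bar>)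
      else 0)"

text \<open>
  The integrals of nonnegative functions are taken in \<^typ>\<open>ennreal\<close>, so they may be infinite, and
  $0 \cdot \infty = 0$ in the integrands.
\<close>

definition strong_upper_gradient ::
  "('a::metric_space \<Rightarrow> ereal) \<Rightarrow> ('a \<Rightarrow> ereal) \<Rightarrow> bool" where
  "strong_upper_gradient \<Phi> g \<longleftrightarrow>
     (\<forall>u. 0 \<le> g u) \<and>
     (\<forall>v. loc_abs_cont v \<and> (\<forall>t>0. v t \<in> eff_dom \<Phi>) \<longrightarrow>
        (\<lambda>r. g (v r)) \<in> borel_measurable (restrict_space borel {0<..}) \<and>
        (\<forall>s t. 0 < s \<and> s \<le> t \<longrightarrow>
           \<bar>\<Phi> (v t) - \<Phi> (v s)\<bar>
             \<le> enn2ereal (\<integral>\<^sup>+r\<in>{s..t}. e2ennreal (g (v r)) * ennreal (metric_deriv v r) \<partial>lborel)))"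

definition oriented_integral :: "real \<Rightarrow> real \<Rightarrow> (real \<Rightarrow> ennreal) \<Rightarrow> ereal" where
  "oriented_integral s t f =
     (if s \<le> t then enn2ereal (\<integral>\<^sup>+r\<in>{s..t}. f r \<partial>lborel)
      else - enn2ereal (\<integral>\<^sup>+r\<in>{t..s}. f r \<partial>lborel))"

text \<open>
  The energy inequality is required for all positive \<open>s\<close>, \<open>t\<close> in either order, so that with the
  oriented integrals it amounts to an equality. The two integral terms always have the same sign,
  hence their sum in \<^typ>\<open>ereal\<close> is never of the form $\infty - \infty$.
\<close>

definition gradient_flow ::
  "('a::metric_space \<Rightarrow> ereal) \<Rightarrow> ('a \<Rightarrow> ereal) \<Rightarrow> (real \<Rightarrow> 'a) \<Rightarrow> bool" where
  "gradient_flow \<Phi> g v \<longleftrightarrow>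
     loc_abs_cont v \<and>
     (\<forall>t>0. v t \<in> eff_dom \<Phi>) \<and>
     (\<forall>s>0. \<forall>t>0.
        \<Phi> (v t) - \<Phi> (v s)
          \<le> - (ereal (1/2) * oriented_integral s t (\<lambda>r. (ennreal (metric_deriv v r))\<^sup>2))
            - ereal (1/2) * oriented_integral s t (\<lambda>r. (e2ennreal (g (v r)))\<^sup>2))"

definition flow_starting_points ::
  "('a::metric_space \<Rightarrow> ereal) \<Rightarrow> ('a \<Rightarrow> ereal) \<Rightarrow> 'a set" where
  "flow_starting_points \<Phi> g =
     {u \<in> eff_dom \<Phi>. \<exists>v. gradient_flow \<Phi> g v \<and>
        (v \<longlongrightarrow> u) (at_right 0) \<and> ((\<lambda>t. \<Phi> (v t)) \<longlongrightarrow> \<Phi> u) (at_right 0)}"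

end

theory Submission
  imports Defs
begin

text \<open>
  Along a gradient flow issuing from a point \<open>w\<close> of the given set, the energy stays below
  \<open>\<Phi> w < inf \<Phi> + 2 / \<gamma>\<close>. At a non-fixed point \<open>u\<close> of \<open>T\<close> the competitor \<open>T u\<close> shows that the slope is
  at least $1 - \frac{\gamma}{2} d(u, T u) \ge 1 - \frac{\gamma}{2}(\Phi(u) - \inf \Phi)$, hence bounded
  below by a constant \<open>c > 0\<close> along the flow. The squared slope is integrable over $[1,\infty)$, so the
  slope drops below \<open>c\<close> at some time \<open>t\<close>, where the flow is at a fixed point. Translating the flow by \<open>t\<close>
  shows that this point is a starting point: the energy is right-continuous at \<open>t\<close> because it is
  nonincreasing and the finite slope at time \<open>t\<close> bounds its decrease.
\<close>

section \<open>Invariance of integrals, curves and flows under time translation\<close>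

text \<open>The integrand need not be measurable, so measurability of the metric derivative is never an issue.\<close>

lemma nn_integral_lborel_shift:
  fixes f :: "real \<Rightarrow> ennreal"
  shows "(\<integral>\<^sup>+r. f (r + a) \<partial>lborel) = (\<integral>\<^sup>+r. f r \<partial>lborel)"
proof -
  have le: "(\<integral>\<^sup>+r. f (r + a) \<partial>lborel) \<le> (\<integral>\<^sup>+r. f r \<partial>lborel)" for f :: "real \<Rightarrow> ennreal" and a
    \<comment> \<open>Unfolding to the supremum over simple minorants makes the substitution
      available: each minorant \<open>g\<close> is measurable even if \<open>f\<close> is not, and
      \<open>g (r - a)\<close> lies below \<open>f r\<close>.\<close>
    unfolding nn_integral_def[of lborel "\<lambda>r. f (r + a)"]
  proof (rule SUP_least, clarify)
    fix g :: "real \<Rightarrow> ennreal"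
    assume g: "simple_function lborel g" "g \<le> (\<lambda>r. f (r + a))"
    have "integral\<^sup>S lborel g = (\<integral>\<^sup>+r. g r \<partial>lborel)"
      using g(1) by (simp add: nn_integral_eq_simple_integral)
    also have "\<dots> = (\<integral>\<^sup>+r. g (- a + 1 * r) \<partial>lborel)"
      using borel_measurable_simple_function[OF g(1)]
      by (subst nn_integral_real_affine[of g 1 "- a"]) simp_all
    also have "\<dots> \<le> (\<integral>\<^sup>+r. f r \<partial>lborel)"
      using g(2) by (intro nn_integral_mono) (metis add.commute add_minus_cancel le_fun_def mult_1)
    finally show "integral\<^sup>S lborel g \<le> (\<integral>\<^sup>+r. f r \<partial>lborel)" .
  qed
  \<comment> \<open>The reverse inequality is the same one, applied to the translated function and
    the shift \<open>- a\<close>.\<close>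
  show ?thesis
    using le[of f a] le[of "\<lambda>r. f (r + a)" "- a"] by simp
qed

lemma oriented_integral_shift:
  "oriented_integral s t (\<lambda>r. f (r + a)) = oriented_integral (s + a) (t + a) f"
proof -
  have "(\<integral>\<^sup>+r\<in>{p..q}. f (r + a) \<partial>lborel) = (\<integral>\<^sup>+r\<in>{p + a..q + a}. f r \<partial>lborel)" for p q
    by (subst nn_integral_lborel_shift[of "\<lambda>r. f r * indicator {p + a..q + a} r" a, symmetric])
      (auto intro!: nn_integral_cong simp: indicator_def)
  then show ?thesis
    by (simp add: oriented_integral_def)
qed

lemma metric_deriv_shift: "metric_deriv (\<lambda>r. v (r + a)) t = metric_deriv v (t + a)"
  by (simp add: metric_deriv_def ac_simps)

lemma loc_abs_cont_shift:
  assumes "loc_abs_cont v" "0 \<le> a"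
  shows "loc_abs_cont (\<lambda>r. v (r + a))"
proof -
  obtain m :: "real \<Rightarrow> real" where m: "\<And>r. r > 0 \<Longrightarrow> 0 \<le> m r"
    "\<And>s t. 0 < s \<Longrightarrow> s \<le> t \<Longrightarrow> set_integrable lborel {s..t} m"
    "\<And>s t. 0 < s \<Longrightarrow> s \<le> t \<Longrightarrow> dist (v t) (v s) \<le> (LBINT r:{s..t}. m r)"
    using assms(1) unfolding loc_abs_cont_def by blast
  \<comment> \<open>The argument is written \<open>a + 1 * r\<close> to match the affine
    substitution rules used below, with scale 1.\<close>
  have ind: "indicator {s + a..t + a} (a + 1 * r) *\<^sub>R m (a + 1 * r) = indicator {s..t} r *\<^sub>R m (r + a)"
    for s t r :: real
    by (auto simp: indicator_def add.commute)
  have "set_integrable lborel {s..t} (\<lambda>r. m (r + a))" if "0 < s" "s \<le> t" for s t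
    using lborel_integrable_real_affine[of "\<lambda>r. indicator {s + a..t + a} r *\<^sub>R m r" 1 a]
      m(2)[of "s + a" "t + a"] that assms(2)
    unfolding set_integrable_def ind by simp
  moreover have "(LBINT r:{s..t}. m (r + a)) = (LBINT r:{s + a..t + a}. m r)" for s t
    using lborel_integral_real_affine[of 1 "\<lambda>r. indicator {s + a..t + a} r *\<^sub>R m r" a]
    unfolding set_lebesgue_integral_def ind by simp
  ultimately show ?thesis
    unfolding loc_abs_cont_def using m(1,3) assms(2)
    by (intro exI[of _ "\<lambda>r. m (r + a)"]) auto
qed

text \<open>Allows a flow to be restarted at a later time. Since \<open>0 \<le> a\<close>, shifted
  times stay positive, where the conditions on \<open>v\<close> are available.\<close>

lemma gradient_flow_shift:
  assumes "gradient_flow \<Phi> g v" "0 \<le> a"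
  shows "gradient_flow \<Phi> g (\<lambda>r. v (r + a))"
  unfolding gradient_flow_def metric_deriv_shift
    oriented_integral_shift[of _ _ "\<lambda>r. (ennreal (metric_deriv v r))\<^sup>2"]
    oriented_integral_shift[of _ _ "\<lambda>r. (e2ennreal (g (v r)))\<^sup>2"]
  using assms loc_abs_cont_shift[of v a] by (simp add: gradient_flow_def)

section \<open>Right-continuity and energy decay along a flow\<close>

text \<open>The distance to \<open>v t\<close> is dominated by the indefinite integral of the
  density \<open>m\<close> from \<open>t\<close>, which is continuous and vanishes at
  \<open>t\<close>.\<close>

lemma loc_abs_cont_tendsto_at_right:
  assumes "loc_abs_cont v" "0 < t"
  shows "(v \<longlongrightarrow> v t) (at_right t)"
proof -
  obtain m :: "real \<Rightarrow> real" where m: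
    "\<And>s t. 0 < s \<Longrightarrow> s \<le> t \<Longrightarrow> set_integrable lborel {s..t} m"
    "\<And>s t. 0 < s \<Longrightarrow> s \<le> t \<Longrightarrow> dist (v t) (v s) \<le> (LBINT r:{s..t}. m r)"
    using assms(1) unfolding loc_abs_cont_def by blast
  have int: "m integrable_on {t..t + 1}"
    using m(1)[of t "t + 1"] assms(2) by (intro set_borel_integral_eq_integral) simp
  have "continuous_on {t..t + 1} (\<lambda>x. integral {t..x} m)"
    by (rule indefinite_integral_continuous_1[OF int])
  then have "((\<lambda>x. integral {t..x} m) \<longlongrightarrow> integral {t..t} m) (at t within {t..t + 1})"
    unfolding continuous_on_def by (rule bspec) simp
  then have lim: "((\<lambda>x. integral {t..x} m) \<longlongrightarrow> 0) (at_right t)"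
    by (simp add: at_within_Icc_at_right)
  have "((\<lambda>x. dist (v x) (v t)) \<longlongrightarrow> 0) (at_right t)"
  proof (rule tendsto_sandwich[OF _ _ tendsto_const lim])
    show "\<forall>\<^sub>F x in at_right t. dist (v x) (v t) \<le> integral {t..x} m"
      unfolding eventually_at_right_field
    proof (intro exI[of _ "t + 1"] conjI allI impI)
      fix x assume "t < x"
      then show "dist (v x) (v t) \<le> integral {t..x} m"
        using m(2)[of t x] set_borel_integral_eq_integral(2)[OF m(1)[of t x]] assms(2) by simp
    qed simp
  qed simp
  then show ?thesis
    by (rule tendsto_dist_iff[THEN iffD2])
qed

lemma gradient_flow_energy:
  assumes "gradient_flow \<Phi> g v" "0 < s" "s \<le> t"
  shows "\<Phi> (v t) - \<Phi> (v s) \<le> - (ereal (1/2) * enn2ereal (\<integral>\<^sup>+r\<in>{s..t}. (e2ennreal (g (v r)))\<^sup>2 \<partial>lborel))"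
proof -
  define A where "A = ereal (1/2) * oriented_integral s t (\<lambda>r. (ennreal (metric_deriv v r))\<^sup>2)"
  define B where "B = ereal (1/2) * oriented_integral s t (\<lambda>r. (e2ennreal (g (v r)))\<^sup>2)"
  have "0 \<le> A" "0 \<le> B"
    using assms(3) by (simp_all add: A_def B_def oriented_integral_def)
  moreover have "\<Phi> (v t) - \<Phi> (v s) \<le> - A - B"
    using assms unfolding gradient_flow_def A_def B_def by simp
  ultimately have "\<Phi> (v t) - \<Phi> (v s) \<le> - B"
    by (cases A; cases B) (auto intro: order_trans)
  then show ?thesis
    using assms(3) by (simp add: B_def oriented_integral_def)
qed

lemma gradient_flow_antimono:
  assumes "gradient_flow \<Phi> g v" "proper_functional \<Phi>" "0 < s" "s \<le> t"
  shows "\<Phi> (v t) \<le> \<Phi> (v s)"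
proof -
  have "\<Phi> (v t) - \<Phi> (v s) \<le> 0"
    by (rule order_trans[OF gradient_flow_energy[OF assms(1,3,4)]]) simp
  moreover have "\<Phi> (v s) < \<infinity>" "\<Phi> (v s) \<noteq> -\<infinity>"
    using assms by (auto simp: gradient_flow_def proper_functional_def eff_dom_def)
  ultimately show ?thesis
    by (cases "\<Phi> (v s)"; cases "\<Phi> (v t)") auto
qed

lemma gradient_flow_le_start:
  assumes "gradient_flow \<Phi> g v" "proper_functional \<Phi>"
    and "((\<lambda>t. \<Phi> (v t)) \<longlongrightarrow> l) (at_right 0)" "0 < t"
  shows "\<Phi> (v t) \<le> l"
proof (rule tendsto_lowerbound[OF assms(3)])
  show "\<forall>\<^sub>F s in at_right 0. \<Phi> (v t) \<le> \<Phi> (v s)"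
    unfolding eventually_at_right_field
    using gradient_flow_antimono[OF assms(1,2)] assms(4) by (intro exI[of _ t]) auto
qed simp

section \<open>Lower and upper bounds on the slope along a flow\<close>

lemma global_slope_ge:
  assumes "\<Phi> u = ereal a" "\<Phi> v = ereal b" "v \<noteq> u"
  shows "ereal ((a - b) / dist u v - \<gamma> / 2 * dist u v) \<le> global_slope \<gamma> \<Phi> u"
proof -
  have "ereal ((a - b) / dist u v - \<gamma> / 2 * dist u v)
      = (\<Phi> u - \<Phi> v) / ereal (dist u v) - ereal (\<gamma> / 2 * dist u v)"
    using assms by simp
  also have "\<dots> \<le> (SUP v\<in>UNIV - {u}. (\<Phi> u - \<Phi> v) / ereal (dist u v) - ereal (\<gamma> / 2 * dist u v))"
    using assms(3) by (intro SUP_upper) simp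
  also have "\<dots> \<le> global_slope \<gamma> \<Phi> u"
    using assms(1) by (simp add: global_slope_def eff_dom_def)
  finally show ?thesis .
qed

text \<open>If \<open>g\<close> were at least \<open>c\<close> at all positive times, the energy
  would fall at rate at least \<open>c\<^sup>2 / 2\<close> and eventually leave the lower
  bound.\<close>

lemma gradient_flow_slope_small:
  assumes "gradient_flow \<Phi> g v" "proper_functional \<Phi>" "bounded_from_below \<Phi>" "0 < c"
  obtains t where "0 < t" "g (v t) < ereal c"
proof (rule ccontr)
  assume "\<not> thesis"
  then have large: "ereal c \<le> g (v t)" if "0 < t" for t
    using that \<open>\<And>t. 0 < t \<Longrightarrow> g (v t) < ereal c \<Longrightarrow> thesis\<close> not_le by blast
  obtain b where b: "\<And>u. ereal b \<le> \<Phi> u"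
    using assms(3) unfolding bounded_from_below_def by blast
  have "\<Phi> (v 1) < \<infinity>" "\<Phi> (v 1) \<noteq> -\<infinity>"
    using assms by (auto simp: gradient_flow_def proper_functional_def eff_dom_def)
  then obtain p where p: "\<Phi> (v 1) = ereal p"
    by (cases "\<Phi> (v 1)") auto
  \<comment> \<open>With this length the forced decrease \<open>c\<^sup>2 * \<tau> / 2\<close>
    equals \<open>p - b + 1\<close>, so the energy at time \<open>1 + \<tau>\<close> would be at
    most \<open>b - 1\<close>.\<close>
  define \<tau> where "\<tau> = 2 * (p - b + 1) / c\<^sup>2"
  have "b \<le> p"
    using b[of "v 1"] p by simp
  then have "0 \<le> \<tau>"
    unfolding \<tau>_def by simp
  have "ennreal (c\<^sup>2 * \<tau>) = (\<integral>\<^sup>+r\<in>{1..1 + \<tau>}. ennreal (c\<^sup>2) \<partial>lborel)"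
    using \<open>0 \<le> \<tau>\<close> by (simp add: nn_integral_cmult_indicator ennreal_mult)
  also have "\<dots> \<le> (\<integral>\<^sup>+r\<in>{1..1 + \<tau>}. (e2ennreal (g (v r)))\<^sup>2 \<partial>lborel)"
  proof (rule nn_integral_mono)
    fix r :: real
    have "ennreal (c\<^sup>2) \<le> (e2ennreal (g (v r)))\<^sup>2" if "1 \<le> r"
      using e2ennreal_mono[OF large[of r]] that assms(4)
      by (simp add: ennreal_power[symmetric] power_mono)
    then show "ennreal (c\<^sup>2) * indicator {1..1 + \<tau>} r \<le> (e2ennreal (g (v r)))\<^sup>2 * indicator {1..1 + \<tau>} r"
      by (simp add: indicator_def)
  qed
  finally have "ereal (c\<^sup>2 * \<tau>) \<le> enn2ereal (\<integral>\<^sup>+r\<in>{1..1 + \<tau>}. (e2ennreal (g (v r)))\<^sup>2 \<partial>lborel)"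
    using \<open>0 \<le> \<tau>\<close> by (simp add: less_eq_ennreal.rep_eq enn2ereal_ennreal)
  then have "ereal (1/2) * ereal (c\<^sup>2 * \<tau>)
      \<le> ereal (1/2) * enn2ereal (\<integral>\<^sup>+r\<in>{1..1 + \<tau>}. (e2ennreal (g (v r)))\<^sup>2 \<partial>lborel)"
    by (intro ereal_mult_left_mono) simp_all
  then have "\<Phi> (v (1 + \<tau>)) - \<Phi> (v 1) \<le> - (ereal (1/2) * ereal (c\<^sup>2 * \<tau>))"
    using gradient_flow_energy[OF assms(1), of 1 "1 + \<tau>"] \<open>0 \<le> \<tau>\<close>
    by (meson ereal_minus_le_minus le_add_same_cancel1 order_trans zero_less_one)
  moreover have "ereal (1/2) * ereal (c\<^sup>2 * \<tau>) = ereal (p - b + 1)"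
    using assms(4) by (simp add: \<tau>_def)
  ultimately show False
    using p b[of "v (1 + \<tau>)"] by (cases "\<Phi> (v (1 + \<tau>))") auto
qed

text \<open>Testing the slope at \<open>v t\<close> against the competitor \<open>v s\<close> bounds
  the energy loss by a quadratic polynomial in their distance, which tends to 0 as \<open>s\<close>
  decreases to \<open>t\<close>; monotonicity gives the other side of the squeeze.\<close>

lemma gradient_flow_point_is_start:
  assumes flow: "gradient_flow \<Phi> (global_slope \<gamma> \<Phi>) v" and proper: "proper_functional \<Phi>"
    and t: "0 < t" and slope: "global_slope \<gamma> \<Phi> (v t) < ereal c"
  shows "v t \<in> flow_starting_points \<Phi> (global_slope \<gamma> \<Phi>)"
proof -
  have fin: "\<exists>p. \<Phi> (v s) = ereal p" if "0 < s" for s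
  proof -
    have "\<Phi> (v s) < \<infinity>" "\<Phi> (v s) \<noteq> -\<infinity>"
      using flow proper that by (auto simp: gradient_flow_def proper_functional_def eff_dom_def)
    then show ?thesis
      by (cases "\<Phi> (v s)") auto
  qed
  obtain p where p: "\<Phi> (v t) = ereal p"
    using fin[OF t] by blast
  define \<delta> where "\<delta> s = dist (v t) (v s)" for s
  have cont: "(v \<longlongrightarrow> v t) (at_right t)"
    using flow t by (intro loc_abs_cont_tendsto_at_right) (auto simp: gradient_flow_def)
  then have "(\<delta> \<longlongrightarrow> dist (v t) (v t)) (at_right t)"
    unfolding \<delta>_def by (intro tendsto_intros)
  then have "((\<lambda>s. p - (c * \<delta> s + \<gamma> / 2 * (\<delta> s)\<^sup>2)) \<longlongrightarrow> p - (c * dist (v t) (v t) + \<gamma> / 2 * (dist (v t) (v t))\<^sup>2))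
      (at_right t)"
    by (intro tendsto_intros)
  then have lim: "((\<lambda>s. ereal (p - (c * \<delta> s + \<gamma> / 2 * (\<delta> s)\<^sup>2))) \<longlongrightarrow> ereal p) (at_right t)"
    by simp
  have lower: "ereal (p - (c * \<delta> s + \<gamma> / 2 * (\<delta> s)\<^sup>2)) \<le> \<Phi> (v s)" if s: "t < s" for s
  proof -
    obtain q where q: "\<Phi> (v s) = ereal q"
      using fin[of s] s t by auto
    show ?thesis
    \<comment> \<open>The flow may be stationary; then \<open>v s\<close> is no admissible
      competitor, but the bound is trivial.\<close>
    proof (cases "v s = v t")
      case True
      then show ?thesis by (simp add: p \<delta>_def)
    next
      case False
      then have pos: "0 < \<delta> s"
        by (simp add: \<delta>_def)
      have "ereal ((p - q) / \<delta> s - \<gamma> / 2 * \<delta> s) < ereal c"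
        unfolding \<delta>_def using global_slope_ge[where \<gamma> = \<gamma>, OF p q False] slope by (rule order_le_less_trans)
      then have "(p - q) / \<delta> s < c + \<gamma> / 2 * \<delta> s"
        by simp
      then have "p - q < (c + \<gamma> / 2 * \<delta> s) * \<delta> s"
        using pos by (simp add: pos_divide_less_eq)
      then show ?thesis
        by (simp add: q algebra_simps power2_eq_square)
    qed
  qed
  have energy: "((\<lambda>s. \<Phi> (v s)) \<longlongrightarrow> \<Phi> (v t)) (at_right t)"
    unfolding p
  proof (rule tendsto_sandwich[OF _ _ lim tendsto_const])
    show "\<forall>\<^sub>F s in at_right t. ereal (p - (c * \<delta> s + \<gamma> / 2 * (\<delta> s)\<^sup>2)) \<le> \<Phi> (v s)"
      using lower by (intro eventually_at_rightI[of t "t + 1"]) auto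
    show "\<forall>\<^sub>F s in at_right t. \<Phi> (v s) \<le> ereal p"
      using gradient_flow_antimono[OF flow proper t] p
      by (intro eventually_at_rightI[of t "t + 1"]) auto
  qed
  have "gradient_flow \<Phi> (global_slope \<gamma> \<Phi>) (\<lambda>r. v (r + t))"
    using flow t by (intro gradient_flow_shift) auto
  moreover have "((\<lambda>r. v (r + t)) \<longlongrightarrow> v t) (at_right 0)"
      "((\<lambda>r. \<Phi> (v (r + t))) \<longlongrightarrow> \<Phi> (v t)) (at_right 0)"
    using cont energy by (simp_all add: filterlim_at_right_to_0[of _ _ t])
  ultimately show ?thesis
    using flow t unfolding flow_starting_points_def gradient_flow_def[of \<Phi> _ v] by auto
qed

section \<open>A fixed point of \<open>T\<close> on the flow\<close>

theorem proposition3p10: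
  fixes \<Phi> :: "'a::metric_space \<Rightarrow> ereal" and \<gamma> :: real and T :: "'a \<Rightarrow> 'a"
  assumes "proper_functional \<Phi>"
    and "bounded_from_below \<Phi>"
    and "0 \<le> \<gamma>"
    and "strong_upper_gradient \<Phi> (global_slope \<gamma> \<Phi>)"
    and "{w. \<Phi> w < (INF u. \<Phi> u) + (if \<gamma> = 0 then \<infinity> else ereal (2 / \<gamma>))}
           \<inter> flow_starting_points \<Phi> (global_slope \<gamma> \<Phi>) \<noteq> {}"
    and "\<And>v. \<Phi> v \<ge> \<Phi> (T v) + ereal (dist v (T v))"
  shows "\<exists>u \<in> flow_starting_points \<Phi> (global_slope \<gamma> \<Phi>). T u = u"
proof -
  obtain w v where w: "\<Phi> w < (INF u. \<Phi> u) + (if \<gamma> = 0 then \<infinity> else ereal (2 / \<gamma>))"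
    and "w \<in> eff_dom \<Phi>" and flow: "gradient_flow \<Phi> (global_slope \<gamma> \<Phi>) v"
    and start: "((\<lambda>t. \<Phi> (v t)) \<longlongrightarrow> \<Phi> w) (at_right 0)"
    using assms(5) unfolding flow_starting_points_def by auto
  have "\<Phi> w < \<infinity>" "\<Phi> w \<noteq> -\<infinity>"
    using \<open>w \<in> eff_dom \<Phi>\<close> assms(1) by (auto simp: proper_functional_def eff_dom_def)
  then obtain p where p: "\<Phi> w = ereal p"
    by (cases "\<Phi> w") auto
  obtain b where "\<And>u. ereal b \<le> \<Phi> u"
    using assms(2) unfolding bounded_from_below_def by blast
  then have "ereal b \<le> (INF u. \<Phi> u)"
    by (simp add: INF_greatest)
  moreover have "(INF u. \<Phi> u) \<le> ereal p"
    using p by (metis INF_lower UNIV_I)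
  ultimately obtain i where i: "(INF u. \<Phi> u) = ereal i"
    by (cases "INF u. \<Phi> u") auto
  have inf_le: "ereal i \<le> \<Phi> u" for u
    unfolding i[symmetric] by (simp add: INF_lower)
  \<comment> \<open>This is the lower bound for the slope at non-fixed points of the flow, where
    \<open>p - i\<close> bounds the displacement under \<open>T\<close>. It is positive exactly
    because \<open>p < i + 2 / \<gamma>\<close>, and equals 1 if
    \<open>\<gamma> = 0\<close>.\<close>
  define c where "c = 1 - \<gamma> / 2 * (p - i)"
  have "0 < c"
  proof (cases "\<gamma> = 0")
    case False
    then have "p < i + 2 / \<gamma>" "0 < \<gamma>"
      using w p i assms(3) by simp_all
    then show ?thesis
      by (simp add: c_def field_simps)
  qed (simp add: c_def)
  then obtain t where t: "0 < t" and slope: "global_slope \<gamma> \<Phi> (v t) < ereal c"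
    using gradient_flow_slope_small[OF flow assms(1,2)] by blast
  have "T (v t) = v t"
  proof (rule ccontr)
    assume ne: "T (v t) \<noteq> v t"
    define \<delta> where "\<delta> = dist (v t) (T (v t))"
    have "\<Phi> (v t) \<le> ereal p"
      using gradient_flow_le_start[OF flow assms(1) start t] p by simp
    then obtain q where q: "\<Phi> (v t) = ereal q" "q \<le> p"
      using inf_le[of "v t"] by (cases "\<Phi> (v t)") auto
    \<comment> \<open>The inequality for \<open>T\<close> does two things: it makes the energy of
      the competitor \<open>T (v t)\<close> finite, and it yields
      \<open>\<delta> \<le> q - q' \<le> p - i\<close>.\<close>
    obtain q' where q': "\<Phi> (T (v t)) = ereal q'" "i \<le> q'" "q' + \<delta> \<le> q"
      using assms(6)[of "v t"] inf_le[of "T (v t)"] q(1)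
      by (cases "\<Phi> (T (v t))") (auto simp: \<delta>_def)
    have "0 < \<delta>"
      using ne by (simp add: \<delta>_def)
    then have "1 \<le> (q - q') / \<delta>"
      using q'(3) by simp
    moreover have "\<gamma> / 2 * \<delta> \<le> \<gamma> / 2 * (p - i)"
      using q(2) q'(2,3) assms(3) by (intro mult_left_mono) auto
    ultimately have "ereal c \<le> ereal ((q - q') / \<delta> - \<gamma> / 2 * \<delta>)"
      by (simp add: c_def)
    also have "\<dots> \<le> global_slope \<gamma> \<Phi> (v t)"
      unfolding \<delta>_def by (rule global_slope_ge[OF q(1) q'(1) ne])
    finally show False
      using slope by simp
  qed
  then show ?thesis
    using gradient_flow_point_is_start[OF flow assms(1) t slope] by blast
qed

end
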